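(* Let $G$ be a discrete abelian group with torsion-free rank $r_0(G) < 2^{\omega}$, where $2^{\omega}$ is the cardinality of the continuum, and let $\mathcal{K}$ be a finite set of finite subsets of $G$. Then $\mathcal{K}$ has the Pompeiu property (with respect to the class of all complex-valued functions on $G$) if and only if $\bigcap_{K \in \mathcal{K}} Z(\chi_K) = \emptyset$.
   Context: The torsion-free rank $r_0(G)$ of an abelian group $G$ is the cardinality of a maximal independent system of elements of infinite order in $G$. Pompeiu property: $\mathcal{K}$ has the Pompeiu property if $f=0$ is the only function $f\colon G\to\mathbb{C}$ such that $\sum_{x\in gK} f(x)=0$ for all $K\in\mathcal{K}$ and all $g\in G$. $\mathbb{C}G$ is the complex group ring of $G$, whose elements are finite formal sums $\sum_{g\in G}a_g g$, equivalently finitely supported functions $G\to\mathbb{C}$ under convolution. For a finite subset $K\subseteq G$, $\chi_K=\sum_{g\in K} g\in\mathbb{C}G$ is its characteristic function. When $r_0(G)<2^\omega$, it is known (Laczkovich–Székelyhidi) that for every maximal ideal $M$ of $\mathbb{C}G$ the field $\mathbb{C}G/M$ is isomorphic to $\mathbb{C}$ (as a $\mathbb{C}$-algebra). So the natural quotient map $i_M\colon\mathbb{C}G\to\mathbb{C}G/M$ is regarded as a surjective ring ($\mathbb{C}$-algebra) homomorphism $i_M\colon\mathbb{C}G\to\mathbb{C}$ with kernel $M$. For $\alpha\in\mathbb{C}G$, $Z(\alpha)=\{\, i_M : M \text{ a maximal ideal of }\mathbb{C}G,\ i_M(\alpha)=0\,\}$, a subset of the set of all maps $i_M$ (intersections are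 taken inside this set). *)

theory Defs
  imports
    Complex_Main
    "HOL-Library.Poly_Mapping"
    "HOL-Decision_Procs.Algebra_Aux"
    "HOL-Algebra.Multiplicative_Group"
    "HOL-Algebra.QuotRing"
begin

unbundle cardinal_syntax

definition indep_system :: "('a, 'b) monoid_scheme \<Rightarrow> 'a set \<Rightarrow> bool" where
  "indep_system G A \<longleftrightarrow>
     A \<subseteq> carrier G \<and> (\<forall>x\<in>A. group.ord G x = 0) \<and>
     (\<forall>F (n :: 'a \<Rightarrow> int). finite F \<longrightarrow> F \<subseteq> A \<longrightarrow>
        (\<Otimes>\<^bsub>G\<^esub>x\<in>F. x [^]\<^bsub>G\<^esub> n x) = \<one>\<^bsub>G\<^esub> \<longrightarrow>
        (\<forall>x\<in>F. x [^]\<^bsub>G\<^esub> n x = \<one>\<^bsub>G\<^esub>))"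
  \<comment> \<open>\<^const>\<open>group.ord\<close> is \<open>0\<close> exactly on the elements of infinite order.\<close>

definition maximal_indep_system :: "('a, 'b) monoid_scheme \<Rightarrow> 'a set \<Rightarrow> bool" where
  "maximal_indep_system G A \<longleftrightarrow>
     indep_system G A \<and> (\<forall>B. indep_system G B \<longrightarrow> A \<subseteq> B \<longrightarrow> B = A)"

text \<open>All maximal independent systems have the same cardinality, so the choice below is
  immaterial up to \<open>=o\<close>.\<close>

definition torsion_free_rank :: "('a, 'b) monoid_scheme \<Rightarrow> 'a rel" where
  "torsion_free_rank G = |SOME A. maximal_indep_system G A|"

definition pompeiu_property :: "('a, 'b) monoid_scheme \<Rightarrow> 'a set set \<Rightarrow> bool" where
  "pompeiu_property G \<K> \<longleftrightarrow>
     (\<forall>f :: 'a \<Rightarrow> complex.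
        (\<forall>K\<in>\<K>. \<forall>g\<in>carrier G. (\<Sum>x\<in>g <#\<^bsub>G\<^esub> K. f x) = 0) \<longrightarrow>
        (\<forall>x\<in>carrier G. f x = 0))"

text \<open>The multiplication of \<^typ>\<open>'a \<Rightarrow>\<^sub>0 complex\<close> in the library presupposes an additive
  type class on \<^typ>\<open>'a\<close>; here the convolution is the one given by the group \<open>G\<close>.\<close>

definition group_ring :: "('a, 'b) monoid_scheme \<Rightarrow> ('a \<Rightarrow>\<^sub>0 complex) ring" where
  "group_ring G =
     \<lparr>carrier = {a. Poly_Mapping.keys a \<subseteq> carrier G},
      mult = (\<lambda>a b. \<Sum>g\<in>Poly_Mapping.keys a. \<Sum>h\<in>Poly_Mapping.keys b.
                Poly_Mapping.single (g \<otimes>\<^bsub>G\<^esub> h)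
                  (Poly_Mapping.lookup a g * Poly_Mapping.lookup b h)),
      one = Poly_Mapping.single \<one>\<^bsub>G\<^esub> 1,
      zero = 0,
      add = (+)\<rparr>"

definition group_ring_scalar :: "('a, 'b) monoid_scheme \<Rightarrow> complex \<Rightarrow> ('a \<Rightarrow>\<^sub>0 complex)" where
  "group_ring_scalar G c = Poly_Mapping.single \<one>\<^bsub>G\<^esub> c"

definition char_elem :: "'a set \<Rightarrow> ('a \<Rightarrow>\<^sub>0 complex)" where
  "char_elem K = (\<Sum>g\<in>K. Poly_Mapping.single g 1)"

text \<open>A \<open>\<complex>\<close>-algebra isomorphism from \<open>\<complex>G/M\<close> to \<open>\<complex>\<close>. It is unique on the carrier of the
  quotient, since it is inverse to the structure map \<open>\<complex> \<rightarrow> \<complex>G/M\<close>; it exists for every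
  maximal ideal \<open>M\<close> if \<open>r\<^sub>0(G) < 2\<^sup>\<omega>\<close>.\<close>

definition quotient_iso ::
  "('a, 'b) monoid_scheme \<Rightarrow> ('a \<Rightarrow>\<^sub>0 complex) set \<Rightarrow> ('a \<Rightarrow>\<^sub>0 complex) set \<Rightarrow> complex" where
  "quotient_iso G M =
     (SOME \<iota>. \<iota> \<in> ring_iso (group_ring G Quot M) cring_class_ops \<and>
        (\<forall>c. \<iota> (M +>\<^bsub>group_ring G\<^esub> group_ring_scalar G c) = c))"

definition quotient_map ::
  "('a, 'b) monoid_scheme \<Rightarrow> ('a \<Rightarrow>\<^sub>0 complex) set \<Rightarrow> ('a \<Rightarrow>\<^sub>0 complex) \<Rightarrow> complex" where
  "quotient_map G M =
     (\<lambda>\<alpha>\<in>carrier (group_ring G). quotient_iso G M (M +>\<^bsub>group_ring G\<^esub> \<alpha>))"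

definition quotient_maps ::
  "('a, 'b) monoid_scheme \<Rightarrow> (('a \<Rightarrow>\<^sub>0 complex) \<Rightarrow> complex) set" where
  "quotient_maps G = {quotient_map G M | M. maximalideal M (group_ring G)}"

definition zero_set ::
  "('a, 'b) monoid_scheme \<Rightarrow> ('a \<Rightarrow>\<^sub>0 complex) \<Rightarrow> (('a \<Rightarrow>\<^sub>0 complex) \<Rightarrow> complex) set" where
  "zero_set G \<alpha> =
     {quotient_map G M | M. maximalideal M (group_ring G) \<and> quotient_map G M \<alpha> = 0}"

end

theory Submission
  imports
    Defs
    "HOL-Algebra.Free_Abelian_Groups"
    "HOL-Algebra.Ring_Divisibility"
    "HOL-Computational_Algebra.Fundamental_Theorem_Algebra"
    "HOL-Analysis.Continuum_Not_Denumerable"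
begin

text \<open>
  A function \<open>f\<close> violates the Pompeiu property iff it annihilates all translates of the
  \<open>\<chi>\<^sub>K\<close>, and the elements of \<open>\<complex>G\<close> all of whose translates are annihilated by \<open>f\<close> form an
  ideal. If \<open>f \<noteq> 0\<close>, this ideal is proper and lies in a maximal one; conversely, a maximal ideal \<open>M\<close>
  containing all \<open>\<chi>\<^sub>K\<close> yields the violating function \<open>f x = i\<^sub>M x\<close>, provided that
  \<open>\<complex>G/M\<close> is \<open>\<complex>\<close>.

  That \<open>\<complex>G/M\<close> is \<open>\<complex>\<close> is an Amitsur-type argument. Elements of \<open>G\<close> with equal
  \<open>k\<close>-th powers differ modulo \<open>M\<close> by a \<open>k\<close>-th root of unity, and every element has a positive
  power in the subgroup generated by a maximal independent system, so \<open>\<complex>G/M\<close> is spanned by fewer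
  than \<open>2\<^sup>\<omega>\<close> elements. If no \<open>\<alpha> - c\<close> were in \<open>M\<close>, then infinitely many of the resolvents
  \<open>1/(\<alpha> - c)\<close> would lie in the span of finitely many elements; a linear relation between them,
  cleared of denominators, is a nonzero polynomial \<open>p\<close> with \<open>p(\<alpha>) \<in> M\<close>, and some linear
  factor of \<open>p\<close> gives \<open>\<alpha> - c \<in> M\<close>.
\<close>

section \<open>The group algebra\<close>

lemma group_ring_carrier: "a \<in> carrier (group_ring G) \<longleftrightarrow> Poly_Mapping.keys a \<subseteq> carrier G"
  by (simp add: group_ring_def)

lemma group_ring_one: "\<one>\<^bsub>group_ring G\<^esub> = Poly_Mapping.single \<one>\<^bsub>G\<^esub> 1"
  by (simp add: group_ring_def)

lemma group_ring_zero [simp]: "\<zero>\<^bsub>group_ring G\<^esub> = 0"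
  by (simp add: group_ring_def)

lemma group_ring_add [simp]: "a \<oplus>\<^bsub>group_ring G\<^esub> b = a + b"
  by (simp add: group_ring_def)

lemma group_ring_mult:
  "a \<otimes>\<^bsub>group_ring G\<^esub> b = (\<Sum>g\<in>Poly_Mapping.keys a. \<Sum>h\<in>Poly_Mapping.keys b.
     Poly_Mapping.single (g \<otimes>\<^bsub>G\<^esub> h) (Poly_Mapping.lookup a g * Poly_Mapping.lookup b h))"
  by (simp add: group_ring_def)

lemma group_ring_mult_zero [simp]:
  "0 \<otimes>\<^bsub>group_ring G\<^esub> a = 0" "a \<otimes>\<^bsub>group_ring G\<^esub> 0 = 0"
  by (simp_all add: group_ring_mult)

text \<open>Biadditivity holds on the whole type, not only on elements supported in
  \<open>carrier G\<close>, so later computations distribute without closure conditions.\<close>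

lemma group_ring_mult_add_left:
  "(a + b) \<otimes>\<^bsub>group_ring G\<^esub> c = a \<otimes>\<^bsub>group_ring G\<^esub> c + b \<otimes>\<^bsub>group_ring G\<^esub> c"
  unfolding group_ring_mult
  by (rule setsum_keys_plus_distrib
        [where f = "\<lambda>g x. \<Sum>h\<in>Poly_Mapping.keys c. Poly_Mapping.single (g \<otimes>\<^bsub>G\<^esub> h) (x * Poly_Mapping.lookup c h)"])
     (simp_all add: distrib_right single_add sum.distrib)

lemma group_ring_mult_add_right:
  "a \<otimes>\<^bsub>group_ring G\<^esub> (b + c) = a \<otimes>\<^bsub>group_ring G\<^esub> b + a \<otimes>\<^bsub>group_ring G\<^esub> c"
  unfolding group_ring_mult sum.distrib[symmetric]
  by (intro sum.cong refl
        setsum_keys_plus_distrib[where f = "\<lambda>h y. Poly_Mapping.single (_ \<otimes>\<^bsub>G\<^esub> h) (Poly_Mapping.lookup a _ * y)"])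
     (simp_all add: distrib_left single_add)

lemma group_ring_mult_single:
  "Poly_Mapping.single g c \<otimes>\<^bsub>group_ring G\<^esub> Poly_Mapping.single h d =
     Poly_Mapping.single (g \<otimes>\<^bsub>G\<^esub> h) (c * d)"
  by (cases "c = 0 \<or> d = 0") (auto simp: group_ring_mult)

lemma poly_mapping_sum_single:
  "(a :: 'a \<Rightarrow>\<^sub>0 'b::comm_monoid_add) = (\<Sum>g\<in>Poly_Mapping.keys a. Poly_Mapping.single g (Poly_Mapping.lookup a g))"
  by (rule poly_mapping_eqI)
     (simp add: lookup_sum lookup_single when_def in_keys_iff if_distrib sum.delta)

lemma group_ring_sum_closed:
  "(\<And>i. i \<in> I \<Longrightarrow> f i \<in> carrier (group_ring G)) \<Longrightarrow> sum f I \<in> carrier (group_ring G)"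
  unfolding group_ring_carrier using keys_sum[of f I] by blast

text \<open>Every element is a finite sum of multiples of group elements. Statements additive in an
  argument, such as commutativity and associativity, thereby reduce to the group law.\<close>

lemma group_ring_induct [consumes 1, case_names zero single add]:
  assumes "a \<in> carrier (group_ring G)"
    and zero: "P 0"
    and single: "\<And>g c. g \<in> carrier G \<Longrightarrow> P (Poly_Mapping.single g c)"
    and add: "\<And>a b. a \<in> carrier (group_ring G) \<Longrightarrow> b \<in> carrier (group_ring G) \<Longrightarrow>
       P a \<Longrightarrow> P b \<Longrightarrow> P (a + b)"
  shows "P a"
proof -
  have *: "P (\<Sum>g\<in>S. Poly_Mapping.single g (Poly_Mapping.lookup a g))"
    if "finite S" "S \<subseteq> carrier G" for S
    using that
  proof (induction S rule: finite_induct)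
    case (insert g S)
    then show ?case
      by (auto intro!: add single group_ring_sum_closed simp: group_ring_carrier)
  qed (simp add: zero)
  show ?thesis
    using *[of "Poly_Mapping.keys a"] assms(1)
    by (simp add: group_ring_carrier poly_mapping_sum_single[symmetric])
qed

text \<open>A separate locale: a sublocale declaration \<open>comm_group \<subseteq> cring\<close> would not
  terminate, because the additive group of \<open>\<complex>G\<close> is again a commutative group.\<close>

locale group_algebra = comm_group G for G (structure)
begin

abbreviation R where "R \<equiv> group_ring G"

lemma single_closed [simp]: "g \<in> carrier G \<Longrightarrow> Poly_Mapping.single g c \<in> carrier R"
  by (simp add: group_ring_carrier)

lemma group_ring_mult_closed:
  assumes "a \<in> carrier R" "b \<in> carrier R"
  shows "a \<otimes>\<^bsub>R\<^esub> b \<in> carrier R"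
  using assms unfolding group_ring_mult
  by (intro group_ring_sum_closed single_closed m_closed) (auto simp: group_ring_carrier)

lemma group_ring_add_closed:
  "a \<in> carrier R \<Longrightarrow> b \<in> carrier R \<Longrightarrow> a + b \<in> carrier R"
  using keys_add[of a b] by (auto simp: group_ring_carrier)

lemma group_ring_mult_comm:
  assumes "a \<in> carrier R" "b \<in> carrier R"
  shows "a \<otimes>\<^bsub>R\<^esub> b = b \<otimes>\<^bsub>R\<^esub> a"
  using assms
proof (induction a rule: group_ring_induct)
  case (single g c)
  from single(2,1) show ?case
    by (induction b rule: group_ring_induct)
       (simp_all add: group_ring_mult_add_left group_ring_mult_add_right group_ring_mult_single m_comm mult.commute)
qed (simp_all add: group_ring_mult_add_left group_ring_mult_add_right)

lemma group_ring_mult_assoc: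
  assumes "a \<in> carrier R" "b \<in> carrier R" "c \<in> carrier R"
  shows "a \<otimes>\<^bsub>R\<^esub> b \<otimes>\<^bsub>R\<^esub> c = a \<otimes>\<^bsub>R\<^esub> (b \<otimes>\<^bsub>R\<^esub> c)"
  using assms
proof (induction a rule: group_ring_induct)
  case (single g x)
  from single(2,1,3) show ?case
  proof (induction b rule: group_ring_induct)
    case (single h y)
    from single(3,1,2) show ?case
      by (induction c rule: group_ring_induct)
         (simp_all add: group_ring_mult_add_left group_ring_mult_add_right group_ring_mult_single m_assoc mult.assoc)
  qed (simp_all add: group_ring_mult_add_left group_ring_mult_add_right)
qed (simp_all add: group_ring_mult_add_left group_ring_mult_add_right)

lemma group_ring_mult_one:
  assumes "a \<in> carrier R"
  shows "\<one>\<^bsub>R\<^esub> \<otimes>\<^bsub>R\<^esub> a = a"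
  using assms
  by (induction a rule: group_ring_induct)
     (simp_all add: group_ring_one group_ring_mult_add_right group_ring_mult_single)

lemma cring_group_ring: "cring R"
proof (rule cringI)
  show "abelian_group R"
  proof (rule abelian_groupI)
    show "\<exists>y\<in>carrier R. y \<oplus>\<^bsub>R\<^esub> x = \<zero>\<^bsub>R\<^esub>" if "x \<in> carrier R" for x
      using that by (intro bexI[of _ "- x"]) (auto simp: group_ring_carrier in_keys_iff)
  qed (auto simp: group_ring_add_closed add.assoc add.commute, simp add: group_ring_carrier)
  show "comm_monoid R"
  proof (rule comm_monoidI)
    show "\<one>\<^bsub>R\<^esub> \<in> carrier R" by (simp add: group_ring_one)
  qed (rule group_ring_mult_closed group_ring_mult_assoc group_ring_mult_one group_ring_mult_comm;
       assumption)+
qed (simp add: group_ring_mult_add_left)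

end

sublocale group_algebra \<subseteq> group_ring: cring "group_ring G"
  by (rule cring_group_ring)

context group_algebra
begin

lemma group_ring_a_inv [simp]:
  assumes "a \<in> carrier R"
  shows "\<ominus>\<^bsub>R\<^esub> a = - a"
proof (rule group_ring.minus_equality)
  show "- a \<in> carrier R" using assms by (auto simp: group_ring_carrier in_keys_iff)
qed (use assms in auto)

lemma group_ring_minus [simp]:
  "a \<in> carrier R \<Longrightarrow> b \<in> carrier R \<Longrightarrow> a \<ominus>\<^bsub>R\<^esub> b = a - b"
  by (simp add: a_minus_def)

lemma group_ring_diff_closed:
  "a \<in> carrier R \<Longrightarrow> b \<in> carrier R \<Longrightarrow> a - b \<in> carrier R"
  using group_ring.minus_closed[of a b] by simp

end

text \<open>Coefficientwise scaling does not mention \<open>G\<close>, so it makes the whole type a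
  vector space and gives access to spans and linear dependence. On the carrier it is multiplication
  by a scalar, by \<open>scalar_mult\<close>.\<close>

definition gscale :: "complex \<Rightarrow> ('a \<Rightarrow>\<^sub>0 complex) \<Rightarrow> ('a \<Rightarrow>\<^sub>0 complex)" where
  "gscale c a = Poly_Mapping.map ((*) c) a"

lemma lookup_gscale [simp]: "Poly_Mapping.lookup (gscale c a) k = c * Poly_Mapping.lookup a k"
  by (simp add: gscale_def Poly_Mapping.map.rep_eq when_def)

interpretation gvec: vector_space gscale
  by unfold_locales (auto intro!: poly_mapping_eqI simp: lookup_add algebra_simps)

lemma gscale_single: "gscale c (Poly_Mapping.single g d) = Poly_Mapping.single g (c * d)"
  by (auto intro!: poly_mapping_eqI simp: lookup_single when_def)

context group_algebra
begin

lemma scalar_closed [simp]: "group_ring_scalar G c \<in> carrier R"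
  by (simp add: group_ring_scalar_def)

lemma scalar_0 [simp]: "group_ring_scalar G 0 = 0"
  by (simp add: group_ring_scalar_def)

lemma scalar_mult:
  assumes "a \<in> carrier R"
  shows "group_ring_scalar G c \<otimes>\<^bsub>R\<^esub> a = gscale c a"
  using assms
  by (induction a rule: group_ring_induct)
     (simp_all add: group_ring_scalar_def group_ring_mult_add_right group_ring_mult_single
        gscale_single gvec.scale_right_distrib)

lemma gscale_closed [simp]: "a \<in> carrier R \<Longrightarrow> gscale c a \<in> carrier R"
  by (simp flip: scalar_mult)

lemma scalar_eq_gscale_one: "group_ring_scalar G c = gscale c \<one>\<^bsub>R\<^esub>"
  by (simp add: group_ring_scalar_def group_ring_one gscale_single)

section \<open>Evaluation of complex polynomials in the group algebra\<close>

definition poly_eval :: "('a \<Rightarrow>\<^sub>0 complex) \<Rightarrow> complex poly \<Rightarrow> ('a \<Rightarrow>\<^sub>0 complex)" where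
  "poly_eval \<alpha> p = fold_coeffs (\<lambda>c v. group_ring_scalar G c + \<alpha> \<otimes>\<^bsub>R\<^esub> v) p 0"

lemma poly_eval_0 [simp]: "poly_eval \<alpha> 0 = 0"
  by (simp add: poly_eval_def)

lemma poly_eval_pCons: "poly_eval \<alpha> (pCons c p) = group_ring_scalar G c + \<alpha> \<otimes>\<^bsub>R\<^esub> poly_eval \<alpha> p"
  by (cases "c = 0 \<and> p = 0") (auto simp: poly_eval_def group_ring_scalar_def)

lemma poly_eval_closed [simp]: "\<alpha> \<in> carrier R \<Longrightarrow> poly_eval \<alpha> p \<in> carrier R"
  by (induction p) (auto simp: poly_eval_pCons group_ring_add_closed group_ring_carrier[of 0])

lemma poly_eval_add: "\<alpha> \<in> carrier R \<Longrightarrow> poly_eval \<alpha> (p + q) = poly_eval \<alpha> p + poly_eval \<alpha> q"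
  by (induction p q rule: poly_induct2)
     (auto simp: poly_eval_pCons group_ring_mult_add_right group_ring_scalar_def single_add)

lemma gscale_mult_right:
  "a \<in> carrier R \<Longrightarrow> b \<in> carrier R \<Longrightarrow> a \<otimes>\<^bsub>R\<^esub> gscale c b = gscale c (a \<otimes>\<^bsub>R\<^esub> b)"
  by (simp flip: scalar_mult add: group_ring.m_lcomm)

lemma poly_eval_smult: "\<alpha> \<in> carrier R \<Longrightarrow> poly_eval \<alpha> (smult c p) = gscale c (poly_eval \<alpha> p)"
  by (induction p)
     (auto simp: poly_eval_pCons gscale_mult_right gvec.scale_right_distrib group_ring_scalar_def gscale_single)

lemma poly_eval_mult: "\<alpha> \<in> carrier R \<Longrightarrow> poly_eval \<alpha> (p * q) = poly_eval \<alpha> p \<otimes>\<^bsub>R\<^esub> poly_eval \<alpha> q"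
  by (induction p)
     (auto simp: poly_eval_pCons poly_eval_add poly_eval_smult group_ring_mult_add_left scalar_mult group_ring.m_assoc)

lemma poly_eval_const: "poly_eval \<alpha> [:c:] = group_ring_scalar G c"
  by (simp add: poly_eval_pCons)

lemma poly_eval_linear: "\<alpha> \<in> carrier R \<Longrightarrow> poly_eval \<alpha> [:- c, 1:] = \<alpha> - group_ring_scalar G c"
  using group_ring.r_one[of \<alpha>]
  by (simp add: poly_eval_pCons group_ring_scalar_def group_ring_one single_uminus)

end

section \<open>Counting modulo bounded powers\<close>

text \<open>Zorn's lemma: a relation involves only finitely many elements, so in the union of a
  nonempty chain it already lives in one member.\<close>

lemma ex_maximal_indep_system: "\<exists>A. maximal_indep_system G A"
proof -
  have "\<exists>A\<in>Collect (indep_system G). \<forall>X\<in>Collect (indep_system G). A \<subseteq> X \<longrightarrow> X = A"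
  proof (rule subset_Zorn_nonempty)
    show "Collect (indep_system G) \<noteq> {}"
    proof -
      have "indep_system G {}" by (simp add: indep_system_def)
      then show ?thesis by blast
    qed
    fix \<C> assume \<C>: "\<C> \<noteq> {}" "subset.chain (Collect (indep_system G)) \<C>"
    then have ind: "\<And>A. A \<in> \<C> \<Longrightarrow> indep_system G A"
      by (auto simp: subset.chain_def)
    have "indep_system G (\<Union>\<C>)"
      unfolding indep_system_def
    proof (intro conjI allI impI)
      fix F and n :: "'a \<Rightarrow> int"
      assume F: "finite F" "F \<subseteq> \<Union>\<C>" and one: "(\<Otimes>\<^bsub>G\<^esub>x\<in>F. x [^]\<^bsub>G\<^esub> n x) = \<one>\<^bsub>G\<^esub>"
      from finite_subset_Union_chain[OF F \<C>] obtain A where "A \<in> \<C>" "F \<subseteq> A" .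
      with F(1) one ind[of A] show "\<forall>x\<in>F. x [^]\<^bsub>G\<^esub> n x = \<one>\<^bsub>G\<^esub>"
        unfolding indep_system_def by simp
    next
      show "\<Union>\<C> \<subseteq> carrier G"
        using ind unfolding indep_system_def by (intro Union_least) simp
      show "\<forall>x\<in>\<Union>\<C>. group.ord G x = 0"
      proof
        fix x assume "x \<in> \<Union>\<C>"
        then obtain A where "A \<in> \<C>" "x \<in> A" ..
        with ind[of A] show "group.ord G x = 0" unfolding indep_system_def by simp
      qed
    qed
    then show "\<Union>\<C> \<in> Collect (indep_system G)" by simp
  qed
  then show ?thesis by (auto simp: maximal_indep_system_def)
qed

context comm_group
begin

lemma finprod_int_pow_uminus:
  assumes "F \<subseteq> carrier G"
  shows "inv (\<Otimes>x\<in>F. x [^] (n x :: int)) = (\<Otimes>x\<in>F. x [^] (- n x))"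
proof (rule inv_equality)
  have "(\<Otimes>x\<in>F. x [^] (- n x)) \<otimes> (\<Otimes>x\<in>F. x [^] n x) = (\<Otimes>x\<in>F. x [^] (- n x) \<otimes> x [^] n x)"
    using assms by (intro finprod_multf[symmetric]) auto
  also have "\<dots> = (\<Otimes>x\<in>F. \<one>)"
    using assms by (intro finprod_cong) (auto simp: int_pow_neg simp_implies_def)
  finally show "(\<Otimes>x\<in>F. x [^] (- n x)) \<otimes> (\<Otimes>x\<in>F. x [^] n x) = \<one>"
    by simp
qed (use assms in \<open>auto intro!: finprod_closed\<close>)

text \<open>A torsion element has a power equal to the empty product. An element of infinite order
  outside \<open>A\<close> would, by maximality, destroy independence when added, and the resulting
  relation can be solved for a power of it.\<close>

lemma maximal_indep_system_power:
  assumes A: "maximal_indep_system G A" and g: "g \<in> carrier G"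
  obtains k :: nat and F and n :: "'a \<Rightarrow> int"
  where "k > 0" "finite F" "F \<subseteq> A" "g [^] k = (\<Otimes>x\<in>F. x [^] n x)"
proof -
  have ind: "indep_system G A" and max: "\<And>B. indep_system G B \<Longrightarrow> A \<subseteq> B \<Longrightarrow> B = A"
    using A by (auto simp: maximal_indep_system_def)
  have AG: "A \<subseteq> carrier G" and inf: "\<And>x. x \<in> A \<Longrightarrow> ord x = 0"
    and indD: "\<And>F (n :: 'a \<Rightarrow> int) x. finite F \<Longrightarrow> F \<subseteq> A \<Longrightarrow>
        (\<Otimes>x\<in>F. x [^] n x) = \<one> \<Longrightarrow> x \<in> F \<Longrightarrow> x [^] n x = \<one>"
    using ind unfolding indep_system_def by simp_all
  consider "ord g \<noteq> 0" | "ord g = 0" "g \<in> A" | "ord g = 0" "g \<notin> A" by blast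
  then show ?thesis
  proof cases
    case 1
    with g show ?thesis by (intro that[of "ord g" "{}"]) (auto simp: pow_ord_eq_1)
  next
    case 2
    with g show ?thesis by (intro that[of 1 "{g}" "\<lambda>_. 1"]) (auto simp: int_pow_1)
  next
    case 3
    then have "\<not> indep_system G (insert g A)" using max[of "insert g A"] by blast
    moreover have "insert g A \<subseteq> carrier G" "\<forall>x\<in>insert g A. ord x = 0"
      using AG g inf 3 by auto
    ultimately have "\<not> (\<forall>F (n :: 'a \<Rightarrow> int). finite F \<longrightarrow> F \<subseteq> insert g A \<longrightarrow>
        (\<Otimes>x\<in>F. x [^] n x) = \<one> \<longrightarrow> (\<forall>x\<in>F. x [^] n x = \<one>))"
      unfolding indep_system_def by simp
    then obtain F and n :: "'a \<Rightarrow> int" and y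
      where F: "finite F" "F \<subseteq> insert g A" "(\<Otimes>x\<in>F. x [^] n x) = \<one>" "y \<in> F" "y [^] n y \<noteq> \<one>"
      by meson
    define F' where "F' = F - {g}"
    have F': "finite F'" "F' \<subseteq> A" "g \<notin> F'" using F by (auto simp: F'_def)
    have gF: "g \<in> F"
    proof (rule ccontr)
      assume "g \<notin> F"
      with F(2) have "F \<subseteq> A" by (simp add: subset_insert)
      with F indD[of F n y] show False by simp
    qed
    then have "F = insert g F'" by (auto simp: F'_def)
    then have prod: "g [^] n g \<otimes> (\<Otimes>x\<in>F'. x [^] n x) = \<one>"
      using F(3) F' AG g by (subst (asm) (2) \<open>F = insert g F'\<close>, subst (asm) finprod_insert) auto
    have cl: "(\<Otimes>x\<in>F'. x [^] n x) \<in> carrier G"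
      using F' AG by (auto intro!: finprod_closed)
    \<comment> \<open>With exponent 0 at \<open>g\<close> the relation would be one over
      \<open>A\<close>; all its factors would be trivial, including the one at
      \<open>y\<close>.\<close>
    have "n g \<noteq> 0"
    proof
      assume n0: "n g = 0"
      then have "(\<Otimes>x\<in>F'. x [^] n x) = \<one>" using prod cl by simp
      then have "y \<in> F' \<Longrightarrow> y [^] n y = \<one>" using indD[of F' n y] F' by simp
      with F(4,5) n0 show False by (cases "y = g") (auto simp: F'_def)
    qed
    have gn: "g [^] n g = inv (\<Otimes>x\<in>F'. x [^] n x)"
      using prod cl g by (metis int_pow_closed inv_equality)
    \<comment> \<open>The exponent \<open>k\<close> has to be a positive natural number, so a
      negative \<open>n g\<close> is negated on both sides.\<close>
    show ?thesis
    proof (cases "n g > 0")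
      case True
      then have "g [^] nat (n g) = g [^] n g" by (simp add: int_pow_int[symmetric])
      also have "\<dots> = (\<Otimes>x\<in>F'. x [^] (- n x))"
        using gn finprod_int_pow_uminus[of F' n] F' AG by auto
      finally show ?thesis using True F' by (intro that[of "nat (n g)" F' "\<lambda>x. - n x"]) auto
    next
      case False
      then have "g [^] nat (- n g) = g [^] (- n g)" by (simp add: int_pow_int[symmetric])
      also have "\<dots> = (\<Otimes>x\<in>F'. x [^] n x)"
        using gn cl g by (simp add: int_pow_neg)
      finally show ?thesis using False \<open>n g \<noteq> 0\<close> F' by (intro that[of "nat (- n g)" F' n]) auto
    qed
  qed
qed

end

section \<open>Cardinals below the continuum\<close>

lemma card_of_nat_ordLess_real: "|UNIV :: nat set| <o |UNIV :: real set|"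
proof -
  have "\<not> |UNIV :: real set| \<le>o |UNIV :: nat set|"
    using uncountable_UNIV_real by (auto simp: countable_def card_of_ordLeq[symmetric])
  then show ?thesis by simp
qed

lemma card_of_Times_nat_ordLess_real:
  assumes "|X| <o |UNIV :: real set|"
  shows "|X \<times> (UNIV :: nat set)| <o |UNIV :: real set|"
  using card_of_Times_ordLess_infinite[OF _ assms card_of_nat_ordLess_real]
  by (simp add: infinite_UNIV_char_0)

lemma card_of_Fpow_ordLess_real:
  assumes "|X| <o |UNIV :: real set|"
  shows "|Fpow X| <o |UNIV :: real set|"
proof (cases "finite X")
  case True
  then show ?thesis
    by (intro finite_ordLess_infinite2) (auto simp: Fpow_def infinite_UNIV_char_0)
next
  case False
  then show ?thesis using assms card_of_Fpow_infinite ordIso_ordLess_trans by blast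
qed

text \<open>The code of \<open>g\<close> records a relation \<open>g [^] k = (\<Otimes>x\<in>F. x [^] n x)\<close> over a maximal
  independent system, as \<open>k\<close> and the graph of \<open>n\<close> on \<open>F\<close>.\<close>

lemma (in comm_group) rank_code:
  assumes "torsion_free_rank G <o |UNIV :: real set|"
  obtains code :: "'a \<Rightarrow> ('a \<times> int) set \<times> nat"
  where "|code ` carrier G| <o |UNIV :: real set|"
    and "\<And>g h. g \<in> carrier G \<Longrightarrow> h \<in> carrier G \<Longrightarrow> code g = code h \<Longrightarrow>
      \<exists>k::nat>0. g [^] k = h [^] k"
proof -
  \<comment> \<open>This is the very choice made in \<open>torsion_free_rank\<close>, so the
    hypothesis bounds \<open>A\<close> without comparing maximal independent systems.\<close>
  define A where "A = (SOME A. maximal_indep_system G A)"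
  have A: "maximal_indep_system G A"
    unfolding A_def using ex_maximal_indep_system by (rule someI_ex)
  then have "indep_system G A" by (simp add: maximal_indep_system_def)
  then have AG: "A \<subseteq> carrier G" unfolding indep_system_def by (rule conjunct1)
  have "\<exists>k F n. (k::nat) > 0 \<and> finite F \<and> F \<subseteq> A \<and> g [^] k = (\<Otimes>x\<in>F. x [^] (n x :: int))"
    if "g \<in> carrier G" for g
    using maximal_indep_system_power[OF A that] by metis
  then obtain k F n where kFn: "\<And>g. g \<in> carrier G \<Longrightarrow> k g > (0::nat)"
    "\<And>g. g \<in> carrier G \<Longrightarrow> finite (F g)" "\<And>g. g \<in> carrier G \<Longrightarrow> F g \<subseteq> A"
    "\<And>g. g \<in> carrier G \<Longrightarrow> g [^] k g = (\<Otimes>x\<in>F g. x [^] (n g x :: int))"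
    by metis
  define code where "code = (\<lambda>g. ((\<lambda>x. (x, n g x)) ` F g, k g))"
  show ?thesis
  proof (rule that[of code])
    have "|A \<times> (UNIV :: nat set)| <o |UNIV :: real set|"
      using assms by (intro card_of_Times_nat_ordLess_real) (simp add: torsion_free_rank_def A_def)
    moreover have "|A \<times> (UNIV :: int set)| \<le>o |A \<times> (UNIV :: nat set)|"
      by (intro card_of_Times_mono2 card_of_ordLeqI[where f = to_nat]) auto
    ultimately have "|A \<times> (UNIV :: int set)| <o |UNIV :: real set|"
      by (rule ordLeq_ordLess_trans[rotated])
    then have "|Fpow (A \<times> (UNIV :: int set)) \<times> (UNIV :: nat set)| <o |UNIV :: real set|"
      by (intro card_of_Times_nat_ordLess_real card_of_Fpow_ordLess_real)
    moreover have "code ` carrier G \<subseteq> Fpow (A \<times> UNIV) \<times> UNIV"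
    proof (rule image_subsetI)
      fix g assume "g \<in> carrier G"
      from kFn(2,3)[OF this] show "code g \<in> Fpow (A \<times> UNIV) \<times> UNIV"
        by (auto simp: code_def Fpow_def)
    qed
    then have "|code ` carrier G| \<le>o |Fpow (A \<times> (UNIV :: int set)) \<times> (UNIV :: nat set)|"
      by (rule card_of_mono1)
    ultimately show "|code ` carrier G| <o |UNIV :: real set|"
      by (rule ordLeq_ordLess_trans[rotated])
  next
    fix g h assume gh: "g \<in> carrier G" "h \<in> carrier G" "code g = code h"
    then have k: "k g = k h" and img: "(\<lambda>x. (x, n g x)) ` F g = (\<lambda>x. (x, n h x)) ` F h"
      by (auto simp: code_def)
    have F: "F g = F h" using arg_cong[OF img, of "(`) fst"] by (simp add: image_image)
    have n: "n g x = n h x" if "x \<in> F g" for x using that img by auto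
    have "F h \<subseteq> carrier G" using kFn(3)[OF gh(2)] AG by (rule order_trans)
    then have "g [^] k g = h [^] k g"
      using kFn(4)[OF gh(1)] kFn(4)[OF gh(2)] n by (subst (2) k) (auto simp: F intro!: finprod_cong)
    then show "\<exists>k::nat>0. g [^] k = h [^] k" using kFn(1)[OF gh(1)] by blast
  qed
qed

text \<open>If all fibres were finite, a real would be determined by its value and its index within
  the fibre. This would embed the reals into \<open>range f \<times> UNIV\<close> with natural
  second components, which is still smaller than the continuum.\<close>

lemma infinite_fibre:
  fixes f :: "real \<Rightarrow> 'd"
  assumes "|range f| <o |UNIV :: real set|"
  obtains d where "infinite {c. f c = d}"
proof (rule ccontr)
  assume "\<not> thesis"
  with that have fin: "\<And>d. finite {c. f c = d}" by blast
  define h where "h = (\<lambda>c. (f c, to_nat_on {c'. f c' = f c} c))"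
  have "inj h"
  proof (rule injI)
    fix c c' assume "h c = h c'"
    then have *: "f c = f c'" "to_nat_on {x. f x = f c} c = to_nat_on {x. f x = f c} c'"
      by (auto simp: h_def)
    then show "c = c'"
      using inj_on_to_nat_on[OF countable_finite[OF fin[of "f c"]]] by (auto dest: inj_onD)
  qed
  moreover have "range h \<subseteq> range f \<times> UNIV" by (auto simp: h_def)
  ultimately have "|UNIV :: real set| \<le>o |range f \<times> (UNIV :: nat set)|"
    using card_of_ordLeqI by (metis UNIV_I image_subset_iff)
  with card_of_Times_nat_ordLess_real[OF assms] show False
    using not_ordLess_ordLeq by blast
qed

section \<open>Residue fields of the group algebra\<close>

locale maximal_group_algebra = group_algebra +
  fixes M assumes maximal: "maximalideal M R"

sublocale maximal_group_algebra \<subseteq> M: maximalideal M R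
  by (rule maximal)

context maximal_group_algebra
begin

lemma M_subset: "a \<in> M \<Longrightarrow> a \<in> carrier R"
  using M.a_subset by blast

lemma M_zero [simp]: "0 \<in> M"
  using M.zero_closed by simp

lemma M_add: "a \<in> M \<Longrightarrow> b \<in> M \<Longrightarrow> a + b \<in> M"
  using M.a_closed[of a b] by simp

lemma M_mult: "a \<in> carrier R \<Longrightarrow> m \<in> M \<Longrightarrow> a \<otimes>\<^bsub>R\<^esub> m \<in> M"
  by (rule M.I_l_closed)

lemma M_uminus: "a \<in> M \<Longrightarrow> - a \<in> M"
  using M.a_inv_closed[of a] M_subset[of a] by simp

lemma M_diff: "a \<in> M \<Longrightarrow> b \<in> M \<Longrightarrow> a - b \<in> M"
  using M_add[of a "- b"] M_uminus by simp

lemma M_gscale: "a \<in> M \<Longrightarrow> gscale c a \<in> M"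
  using M_mult[of "group_ring_scalar G c" a] M_subset by (simp add: scalar_mult)

lemma M_sum: "(\<And>i. i \<in> I \<Longrightarrow> f i \<in> M) \<Longrightarrow> sum f I \<in> M"
  by (induction I rule: infinite_finite_induct) (auto intro: M_add)

lemma one_notin_M: "\<one>\<^bsub>R\<^esub> \<notin> M"
  using M.I_notcarr M.one_imp_carrier by blast

lemma M_prime:
  assumes "a \<in> carrier R" "b \<in> carrier R" "a \<otimes>\<^bsub>R\<^esub> b \<in> M"
  shows "a \<in> M \<or> b \<in> M"
  using primeideal.I_prime[OF group_ring.maximalideal_prime[OF maximal]] assms by blast

lemma scalar_in_M_iff [simp]: "group_ring_scalar G c \<in> M \<longleftrightarrow> c = 0"
proof
  assume *: "group_ring_scalar G c \<in> M"
  show "c = 0"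
  proof (rule ccontr)
    assume "c \<noteq> 0"
    then have "gscale (inverse c) (group_ring_scalar G c) = \<one>\<^bsub>R\<^esub>"
      by (simp add: scalar_eq_gscale_one)
    with M_gscale[OF *, of "inverse c"] one_notin_M show False by simp
  qed
qed simp

text \<open>The sum of \<open>M\<close> and the principal ideal of \<open>a\<close> properly
  contains \<open>M\<close>, hence is everything; decomposing \<one> in it yields the inverse modulo
  \<open>M\<close>.\<close>

lemma M_inverse:
  assumes a: "a \<in> carrier R" "a \<notin> M"
  obtains b where "b \<in> carrier R" "a \<otimes>\<^bsub>R\<^esub> b - \<one>\<^bsub>R\<^esub> \<in> M"
proof -
  let ?J = "M <+>\<^bsub>R\<^esub> PIdl\<^bsub>R\<^esub> a"
  have J: "ideal ?J R"
    by (intro group_ring.add_ideals M.is_ideal group_ring.cgenideal_ideal a)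
  have "M \<subseteq> ?J"
  proof
    fix m assume "m \<in> M"
    moreover have "0 \<in> PIdl\<^bsub>R\<^esub> a"
      using ideal.Icarr additive_subgroup.zero_closed[OF ideal.axioms(1)[OF group_ring.cgenideal_ideal[OF a(1)]]]
      by simp
    ultimately show "m \<in> ?J"
      unfolding set_add_def' by force
  qed
  moreover have "a \<in> ?J"
    unfolding set_add_def' using group_ring.cgenideal_self[OF a(1)] M_zero by force
  moreover have "?J \<subseteq> carrier R"
    using J by (simp add: additive_subgroup.a_subset ideal.axioms(1))
  ultimately have "?J = carrier R"
    using M.I_maximal[OF J] a by blast
  then have "\<one>\<^bsub>R\<^esub> \<in> ?J" by simp
  then obtain m x where m: "m \<in> M" "x \<in> carrier R" "\<one>\<^bsub>R\<^esub> = m + x \<otimes>\<^bsub>R\<^esub> a"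
    unfolding set_add_def' cgenideal_def by auto
  then have "a \<otimes>\<^bsub>R\<^esub> x - \<one>\<^bsub>R\<^esub> = - m"
    using a by (simp add: group_ring.m_comm)
  with m that[of x] show thesis by (simp add: M_uminus)
qed

text \<open>Over \<complex> a root splits off a linear factor, and since \<open>M\<close> is prime,
  either this factor or the cofactor of smaller degree evaluates into \<open>M\<close>. Degree 0 is
  impossible because \<open>M\<close> contains no nonzero scalar.\<close>

lemma poly_eval_in_M_imp_scalar:
  assumes \<alpha>: "\<alpha> \<in> carrier R" and "p \<noteq> 0" "poly_eval \<alpha> p \<in> M"
  shows "\<exists>c. \<alpha> - group_ring_scalar G c \<in> M"
  using assms(2,3)
proof (induction "degree p" arbitrary: p)
  case 0
  then obtain c where "p = [:c:]" "c \<noteq> 0"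
    by (metis degree_eq_zeroE pCons_0_0)
  with 0 show ?case by (simp add: poly_eval_const)
next
  case (Suc n)
  then have "\<not> constant (poly p)" by (simp add: constant_degree)
  then obtain z where "poly p z = 0" using fundamental_theorem_of_algebra by blast
  then obtain q where q: "p = [:- z, 1:] * q" by (auto simp: poly_eq_0_iff_dvd)
  with Suc.prems have "q \<noteq> 0" by auto
  with q Suc.hyps(2) have "n = degree q" by (simp del: mult_pCons_left add: degree_mult_eq)
  have "(\<alpha> - group_ring_scalar G z) \<otimes>\<^bsub>R\<^esub> poly_eval \<alpha> q \<in> M"
    using Suc.prems(2) \<alpha> unfolding q by (simp only: poly_eval_mult poly_eval_linear)
  then consider "\<alpha> - group_ring_scalar G z \<in> M" | "poly_eval \<alpha> q \<in> M"
    using M_prime[of "\<alpha> - group_ring_scalar G z" "poly_eval \<alpha> q"] \<alpha> group_ring_diff_closed by auto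
  then show ?case
    using Suc.hyps(1)[OF \<open>n = degree q\<close> \<open>q \<noteq> 0\<close>] by cases blast+
qed

text \<open>The \<open>\<beta> c\<close> play the role of the resolvents 1/(\<alpha> - c) modulo
  \<open>M\<close>. Infinitely many of them in a finite-dimensional space are linearly dependent,
  and clearing denominators gives a polynomial that \<alpha> satisfies modulo
  \<open>M\<close>.\<close>

lemma resolvents_finite_dim_imp_scalar:
  assumes \<alpha>: "\<alpha> \<in> carrier R" and F: "finite F" and C: "infinite C"
    and \<beta>: "\<And>c. c \<in> C \<Longrightarrow> \<beta> c \<in> carrier R" "\<And>c. c \<in> C \<Longrightarrow> \<beta> c \<in> gvec.span F"
    and res: "\<And>c. c \<in> C \<Longrightarrow> (\<alpha> - group_ring_scalar G c) \<otimes>\<^bsub>R\<^esub> \<beta> c - \<one>\<^bsub>R\<^esub> \<in> M"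
  shows "\<exists>c. \<alpha> - group_ring_scalar G c \<in> M"
proof -
  \<comment> \<open>A common inverse of \<alpha> - c and \<alpha> - d would satisfy (c - d) \<beta>
    c \<in> \<open>M\<close>, so \<open>\<beta> c\<close> would lie in \<open>M\<close>, which no
    inverse does.\<close>
  have "inj_on \<beta> C"
  proof (rule inj_onI, rule ccontr)
    fix c d assume cd: "c \<in> C" "d \<in> C" "\<beta> c = \<beta> d" "c \<noteq> d"
    let ?r = "\<lambda>c. (\<alpha> - group_ring_scalar G c) \<otimes>\<^bsub>R\<^esub> \<beta> c"
    have eq: "?r x = \<alpha> \<otimes>\<^bsub>R\<^esub> \<beta> x - gscale x (\<beta> x)" if "x \<in> C" for x
      using group_ring_mult_add_left[of G "\<alpha> - group_ring_scalar G x" "group_ring_scalar G x" "\<beta> x"] \<beta>(1)[OF that]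
      by (simp add: scalar_mult)
    have "?r d - ?r c = gscale (c - d) (\<beta> c)"
      using eq[OF cd(1)] eq[OF cd(2)] cd(3) by (simp add: gvec.scale_left_diff_distrib)
    moreover have "?r d - ?r c \<in> M" using M_diff[OF res[OF cd(2)] res[OF cd(1)]] by simp
    ultimately have "gscale (inverse (c - d)) (gscale (c - d) (\<beta> c)) \<in> M"
      by (metis M_gscale)
    then have "\<beta> c \<in> M" using cd(4) by simp
    then have "?r c \<in> M" using \<alpha> by (intro M_mult group_ring_diff_closed) auto
    from M_diff[OF this res[OF cd(1)]] one_notin_M show False by simp
  qed
  then have "infinite (\<beta> ` C)" using C by (simp add: finite_image_iff)
  moreover have "\<beta> ` C \<subseteq> gvec.span F" using \<beta>(2) by blast
  ultimately have "gvec.dependent (\<beta> ` C)"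
    using gvec.independent_span_bound[OF F] by blast
  then obtain T u v0 where T: "finite T" "T \<subseteq> \<beta> ` C" "(\<Sum>v\<in>T. gscale (u v) v) = 0"
    and v0: "v0 \<in> T" "u v0 \<noteq> 0"
    unfolding gvec.dependent_explicit by blast
  from T(2) obtain S where S: "S \<subseteq> C" "inj_on \<beta> S" "T = \<beta> ` S"
    unfolding subset_image_inj by blast
  with v0 T(1) obtain c0 where c0: "c0 \<in> S" "u (\<beta> c0) \<noteq> 0" by blast
  define d where "d = (\<lambda>c. u (\<beta> c))"
  have fin: "finite S" using S T(1) finite_image_iff by blast
  have sum0: "(\<Sum>c\<in>S. gscale (d c) (\<beta> c)) = 0"
    using T(3) S by (simp add: sum.reindex d_def)
  \<comment> \<open>\<open>p\<close> is the numerator of the sum of the fractions d c / (X - c) over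
    the common denominator \<open>P S\<close>.\<close>
  define P where "P = (\<lambda>A. \<Prod>c\<in>A. [:- c, 1 :: complex:])"
  define p where "p = (\<Sum>c\<in>S. smult (d c) (P (S - {c})))"
  have eval_sum: "poly_eval \<alpha> (\<Sum>c\<in>A. f c) = (\<Sum>c\<in>A. poly_eval \<alpha> (f c))" for A and f :: "complex \<Rightarrow> complex poly"
    by (induction A rule: infinite_finite_induct) (auto simp: poly_eval_add \<alpha>)
  have PS: "P S = [:- c, 1:] * P (S - {c})" if "c \<in> S" for c
    unfolding P_def using that fin by (simp only: prod.remove)
  \<comment> \<open>At \<open>c0\<close> every other summand vanishes, since it contains the factor
    X - c0.\<close>
  have "poly p c0 = (\<Sum>c\<in>S. if c = c0 then d c0 * poly (P (S - {c0})) c0 else 0)"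
    unfolding p_def poly_sum using fin c0(1)
    by (intro sum.cong) (auto simp: P_def poly_prod)
  also have "\<dots> \<noteq> 0" using fin c0 by (auto simp: P_def poly_prod d_def)
  finally have "p \<noteq> 0" by auto
  have step: "poly_eval \<alpha> (P S) \<otimes>\<^bsub>R\<^esub> \<beta> c - poly_eval \<alpha> (P (S - {c})) \<in> M" if "c \<in> S" for c
  proof -
    have c: "c \<in> C" "\<beta> c \<in> carrier R" using that S \<beta> by auto
    let ?a = "\<alpha> - group_ring_scalar G c" and ?e = "poly_eval \<alpha> (P (S - {c}))"
    have cl: "?a \<in> carrier R" "?e \<in> carrier R" using \<alpha> group_ring_diff_closed by auto
    have "poly_eval \<alpha> (P S) \<otimes>\<^bsub>R\<^esub> \<beta> c = ?e \<otimes>\<^bsub>R\<^esub> (?a \<otimes>\<^bsub>R\<^esub> \<beta> c)"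
      unfolding PS[OF that] using cl c \<alpha>
      by (simp only: poly_eval_mult poly_eval_linear group_ring.m_assoc group_ring.m_lcomm)
    moreover have "?e \<otimes>\<^bsub>R\<^esub> (?a \<otimes>\<^bsub>R\<^esub> \<beta> c - \<one>\<^bsub>R\<^esub>) \<in> M"
      using res[OF c(1)] cl by (intro M_mult)
    moreover have "?e \<otimes>\<^bsub>R\<^esub> (?a \<otimes>\<^bsub>R\<^esub> \<beta> c) = ?e \<otimes>\<^bsub>R\<^esub> (?a \<otimes>\<^bsub>R\<^esub> \<beta> c - \<one>\<^bsub>R\<^esub>) + ?e"
      using group_ring_mult_add_right[of G ?e "?a \<otimes>\<^bsub>R\<^esub> \<beta> c - \<one>\<^bsub>R\<^esub>" "\<one>\<^bsub>R\<^esub>"] cl by simp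
    ultimately show ?thesis by simp
  qed
  \<comment> \<open>Summed with weights \<open>d c\<close>, the first terms give \<open>P S\<close>
    at \<alpha> times the linear relation, that is 0, and the second give \<open>p\<close> at
    \<alpha>.\<close>
  have "(\<Sum>c\<in>S. gscale (d c) (poly_eval \<alpha> (P S) \<otimes>\<^bsub>R\<^esub> \<beta> c - poly_eval \<alpha> (P (S - {c})))) \<in> M"
    by (intro M_sum M_gscale step)
  also have "(\<Sum>c\<in>S. gscale (d c) (poly_eval \<alpha> (P S) \<otimes>\<^bsub>R\<^esub> \<beta> c - poly_eval \<alpha> (P (S - {c})))) =
      (\<Sum>c\<in>S. gscale (d c) (poly_eval \<alpha> (P S) \<otimes>\<^bsub>R\<^esub> \<beta> c)) - poly_eval \<alpha> p"
    by (simp add: gvec.scale_right_diff_distrib sum_subtractf p_def eval_sum poly_eval_smult \<alpha>)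
  also have "(\<Sum>c\<in>S. gscale (d c) (poly_eval \<alpha> (P S) \<otimes>\<^bsub>R\<^esub> \<beta> c)) = (\<Sum>c\<in>S. poly_eval \<alpha> (P S) \<otimes>\<^bsub>R\<^esub> gscale (d c) (\<beta> c))"
    using S \<beta>(1) \<alpha> by (intro sum.cong) (auto simp: gscale_mult_right)
  also have "\<dots> = poly_eval \<alpha> (P S) \<otimes>\<^bsub>R\<^esub> (\<Sum>c\<in>S. gscale (d c) (\<beta> c))"
    using sum_comp_morphism[where h = "(\<otimes>\<^bsub>R\<^esub>) (poly_eval \<alpha> (P S))" and g = "\<lambda>c. gscale (d c) (\<beta> c)" and A = S]
    by (simp add: group_ring_mult_add_right o_def)
  finally have "poly_eval \<alpha> p \<in> M" using M_uminus[of "- poly_eval \<alpha> p"] by (simp add: sum0)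
  with \<open>p \<noteq> 0\<close> \<alpha> show ?thesis by (intro poly_eval_in_M_imp_scalar)
qed

end

text \<open>Krull's theorem. An ideal is proper exactly if it avoids \<one>, a condition that passes
  to unions of chains, so Zorn's lemma applies.\<close>

lemma (in ring) ex_maximalideal_superset:
  assumes I: "ideal I R" and one: "\<one> \<notin> I"
  obtains M where "maximalideal M R" "I \<subseteq> M"
proof -
  let ?\<A> = "{J. ideal J R \<and> I \<subseteq> J \<and> \<one> \<notin> J}"
  have "\<exists>M\<in>?\<A>. \<forall>X\<in>?\<A>. M \<subseteq> X \<longrightarrow> X = M"
  proof (rule subset_Zorn_nonempty)
    show "?\<A> \<noteq> {}" using assms by blast
    fix \<C> assume \<C>: "\<C> \<noteq> {}" "subset.chain ?\<A> \<C>"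
    then have mem: "\<And>J. J \<in> \<C> \<Longrightarrow> ideal J R \<and> I \<subseteq> J \<and> \<one> \<notin> J"
      by (auto simp: subset.chain_def)
    have "subset.chain {J. ideal J R} \<C>"
      using \<C>(2) by (auto simp: subset.chain_def)
    then have "ideal (\<Union>\<C>) R"
      using chain_Union_is_ideal[of \<C>] \<C>(1) by simp
    with mem \<C>(1) show "\<Union>\<C> \<in> ?\<A>" by blast
  qed
  then obtain M where M: "ideal M R" "I \<subseteq> M" "\<one> \<notin> M"
    and max: "\<And>J. ideal J R \<Longrightarrow> \<one> \<notin> J \<Longrightarrow> M \<subseteq> J \<Longrightarrow> J = M"
    by auto
  have "maximalideal M R"
  proof (rule maximalidealI[OF M(1)])
    show "carrier R \<noteq> M" using M(3) by auto
    show "J = M \<or> J = carrier R" if "ideal J R" "M \<subseteq> J" "J \<subseteq> carrier R" for J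
      using max[OF that(1) _ that(2)] ideal.one_imp_carrier[OF that(1)] by blast
  qed
  with M(2) that show thesis by blast
qed

context maximal_group_algebra
begin

lemma poly_eval_monom:
  assumes "x \<in> carrier G"
  shows "poly_eval (Poly_Mapping.single x 1) (monom 1 k) = Poly_Mapping.single (x [^] k) 1"
proof (induction k)
  case 0
  then show ?case by (simp add: monom_0 poly_eval_const group_ring_scalar_def)
next
  case (Suc k)
  then show ?case
    using assms by (simp add: monom_Suc poly_eval_pCons group_ring_mult_single m_comm)
qed

text \<open>The quotient of \<open>g\<close> and \<open>h\<close> is a root of X^k - 1, hence
  congruent to a scalar modulo \<open>M\<close>; multiplying by \<open>h\<close> gives the
  claim.\<close>

lemma equal_powers_imp_associated:
  assumes gh: "g \<in> carrier G" "h \<in> carrier G" and k: "k > 0" "g [^] (k::nat) = h [^] k"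
  shows "\<exists>c. Poly_Mapping.single g 1 - gscale c (Poly_Mapping.single h 1) \<in> M"
proof -
  define u where "u = Poly_Mapping.single (g \<otimes> inv h) (1::complex)"
  have u: "u \<in> carrier R" using gh by (simp add: u_def)
  let ?p = "monom 1 k + [:- 1 :: complex:]"
  \<comment> \<open>Positivity of \<open>k\<close> keeps the constant -1 away from this
    coefficient.\<close>
  have "coeff ?p k = 1" using k(1) by (simp add: coeff_pCons split: nat.split)
  then have "?p \<noteq> 0" by (metis coeff_0 zero_neq_one)
  have "(g \<otimes> inv h) [^] k = \<one>"
    using gh k(2) by (simp add: nat_pow_distrib nat_pow_inv)
  then have "poly_eval u ?p = 0"
    using u gh unfolding poly_eval_add[OF u]
    by (simp add: u_def poly_eval_monom poly_eval_const group_ring_scalar_def single_uminus)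
  with \<open>?p \<noteq> 0\<close> u obtain c where c: "u - group_ring_scalar G c \<in> M"
    using poly_eval_in_M_imp_scalar[of u ?p] by auto
  let ?h = "Poly_Mapping.single h (1::complex)"
  have "?h \<otimes>\<^bsub>R\<^esub> (u - group_ring_scalar G c) \<in> M" using c gh by (intro M_mult) auto
  moreover have "?h \<otimes>\<^bsub>R\<^esub> u = ?h \<otimes>\<^bsub>R\<^esub> (u - group_ring_scalar G c) + gscale c ?h"
    using group_ring_mult_add_right[of G ?h "u - group_ring_scalar G c" "group_ring_scalar G c"] gh
    by (simp add: group_ring.m_comm[of ?h "group_ring_scalar G c"] scalar_mult)
  moreover have "?h \<otimes>\<^bsub>R\<^esub> u = Poly_Mapping.single g 1"
  proof -
    have "h \<otimes> (g \<otimes> inv h) = g" using gh by (simp add: m_lcomm)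
    then show ?thesis by (simp add: u_def group_ring_mult_single)
  qed
  ultimately show ?thesis by (metis add_diff_cancel)
qed

end

locale small_rank_maximal_ideal = maximal_group_algebra +
  assumes rank: "torsion_free_rank G <o |UNIV :: real set|"
begin

text \<open>Modulo \<open>M\<close> every element is a combination of one representative per code,
  and there are fewer than continuum many finite sets of codes. So, if no scalar works, infinitely
  many inverses of the \<alpha> - c share one such set, and the previous dependence argument
  applies.\<close>

lemma ex_scalar_mod_M:
  assumes \<alpha>: "\<alpha> \<in> carrier R"
  shows "\<exists>c. \<alpha> - group_ring_scalar G c \<in> M"
proof (rule ccontr)
  assume none: "\<nexists>c. \<alpha> - group_ring_scalar G c \<in> M"
  have "\<exists>b. b \<in> carrier R \<and> (\<alpha> - group_ring_scalar G c) \<otimes>\<^bsub>R\<^esub> b - \<one>\<^bsub>R\<^esub> \<in> M" for c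
    using M_inverse[of "\<alpha> - group_ring_scalar G c"] none \<alpha> group_ring_diff_closed scalar_closed by metis
  then obtain b where b: "\<And>c. b c \<in> carrier R"
    "\<And>c. (\<alpha> - group_ring_scalar G c) \<otimes>\<^bsub>R\<^esub> b c - \<one>\<^bsub>R\<^esub> \<in> M"
    by metis
  obtain code :: "'a \<Rightarrow> ('a \<times> int) set \<times> nat"
    where code: "|code ` carrier G| <o |UNIV :: real set|"
      "\<And>g h. g \<in> carrier G \<Longrightarrow> h \<in> carrier G \<Longrightarrow> code g = code h \<Longrightarrow>
        \<exists>k::nat>0. g [^] k = h [^] k"
    using rank_code[OF rank] by blast
  define e where "e = (\<lambda>d. Poly_Mapping.single (inv_into (carrier G) code d) (1::complex))"
  have e_closed: "e (code g) \<in> carrier R" if "g \<in> carrier G" for g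
    using that by (simp add: e_def inv_into_into)
  have "\<exists>r. Poly_Mapping.single g 1 - gscale r (e (code g)) \<in> M" if "g \<in> carrier G" for g
    using that code(2)[of g "inv_into (carrier G) code (code g)"]
      equal_powers_imp_associated[of g "inv_into (carrier G) code (code g)"]
    by (auto simp: e_def inv_into_into f_inv_into_f)
  then obtain r where r: "\<And>g. g \<in> carrier G \<Longrightarrow> Poly_Mapping.single g 1 - gscale (r g) (e (code g)) \<in> M"
    by metis
  \<comment> \<open>\<open>red a\<close> replaces each group element in \<open>a\<close> by the
    matching multiple of its representative. It is congruent to \<open>a\<close> and lies in an
    honest span, which linear dependence requires.\<close>
  define red where "red = (\<lambda>a. \<Sum>g\<in>Poly_Mapping.keys a. gscale (Poly_Mapping.lookup a g) (gscale (r g) (e (code g))))"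
  have red: "red a \<in> carrier R" "a - red a \<in> M" "red a \<in> gvec.span (e ` code ` Poly_Mapping.keys a)"
    if "a \<in> carrier R" for a
  proof -
    have keys: "Poly_Mapping.keys a \<subseteq> carrier G" using that by (simp add: group_ring_carrier)
    then show "red a \<in> carrier R"
      unfolding red_def by (intro group_ring_sum_closed gscale_closed e_closed) blast
    have "a - red a = (\<Sum>g\<in>Poly_Mapping.keys a. gscale (Poly_Mapping.lookup a g)
        (Poly_Mapping.single g 1 - gscale (r g) (e (code g))))"
      by (subst (1) poly_mapping_sum_single[of a])
         (simp add: red_def gvec.scale_right_diff_distrib sum_subtractf gscale_single)
    also have "\<dots> \<in> M" using keys by (intro M_sum M_gscale r) blast
    finally show "a - red a \<in> M" .
    show "red a \<in> gvec.span (e ` code ` Poly_Mapping.keys a)"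
      unfolding red_def by (intro gvec.span_sum gvec.span_scale gvec.span_base) blast
  qed
  \<comment> \<open>Real parameters suffice and match the cardinal bound.\<close>
  define f where "f = (\<lambda>c::real. code ` Poly_Mapping.keys (b (complex_of_real c)))"
  have "range f \<subseteq> Fpow (code ` carrier G)"
    using b(1) by (auto simp: f_def Fpow_def group_ring_carrier)
  then have "|range f| <o |UNIV :: real set|"
    using card_of_Fpow_ordLess_real[OF code(1)] card_of_mono1 ordLeq_ordLess_trans by blast
  then obtain d where d: "infinite {c. f c = d}" by (rule infinite_fibre)
  \<comment> \<open>An infinite fibre is inhabited, so \<open>d\<close> is itself a value of
    \<open>f\<close> and therefore finite.\<close>
  then obtain c0 where "f c0 = d" using not_finite_existsD by auto
  then have "finite (e ` d)" by (auto simp: f_def)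
  moreover have "infinite (complex_of_real ` {c. f c = d})"
    using d by (simp add: finite_image_iff inj_on_def)
  moreover have "red (b c) \<in> gvec.span (e ` d)" if "c \<in> complex_of_real ` {c. f c = d}" for c
    using that red(3)[OF b(1), of c] by (auto simp: f_def)
  moreover have "(\<alpha> - group_ring_scalar G c) \<otimes>\<^bsub>R\<^esub> red (b c) - \<one>\<^bsub>R\<^esub> \<in> M" for c
  proof -
    let ?a = "\<alpha> - group_ring_scalar G c"
    have "?a \<otimes>\<^bsub>R\<^esub> b c = ?a \<otimes>\<^bsub>R\<^esub> (b c - red (b c)) + ?a \<otimes>\<^bsub>R\<^esub> red (b c)"
      using group_ring_mult_add_right[of G ?a "b c - red (b c)" "red (b c)"] by simp
    then have "?a \<otimes>\<^bsub>R\<^esub> red (b c) - \<one>\<^bsub>R\<^esub> =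
        (?a \<otimes>\<^bsub>R\<^esub> b c - \<one>\<^bsub>R\<^esub>) - ?a \<otimes>\<^bsub>R\<^esub> (b c - red (b c))"
      by simp
    moreover have "?a \<otimes>\<^bsub>R\<^esub> (b c - red (b c)) \<in> M"
      using red(2)[OF b(1)] \<alpha> by (intro M_mult group_ring_diff_closed) auto
    ultimately show ?thesis using b(2) M_diff by metis
  qed
  ultimately have "\<exists>c. \<alpha> - group_ring_scalar G c \<in> M"
    by (intro resolvents_finite_dim_imp_scalar[OF \<alpha>, where \<beta> = "\<lambda>c. red (b c)"]) (auto simp: red(1) b(1))
  with none show False by blast
qed

section \<open>The residue homomorphism onto the complex numbers\<close>

definition val :: "('a \<Rightarrow>\<^sub>0 complex) \<Rightarrow> complex" where
  "val \<alpha> = (THE c. \<alpha> - group_ring_scalar G c \<in> M)"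

text \<open>Two candidates differ by a scalar in \<open>M\<close>, which must be 0.\<close>

lemma val_eqI:
  assumes "\<alpha> - group_ring_scalar G c \<in> M"
  shows "val \<alpha> = c"
  unfolding val_def
proof (rule the_equality)
  fix d assume "\<alpha> - group_ring_scalar G d \<in> M"
  from M_diff[OF this assms] have "group_ring_scalar G (c - d) \<in> M"
    by (simp add: group_ring_scalar_def single_diff)
  then show "d = c" by simp
qed (rule assms)

lemma diff_val_in_M: "\<alpha> \<in> carrier R \<Longrightarrow> \<alpha> - group_ring_scalar G (val \<alpha>) \<in> M"
  using ex_scalar_mod_M val_eqI by blast

lemma val_add:
  assumes "a \<in> carrier R" "b \<in> carrier R"
  shows "val (a + b) = val a + val b"
  using M_add[OF diff_val_in_M[OF assms(1)] diff_val_in_M[OF assms(2)]]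
  by (intro val_eqI) (simp add: group_ring_scalar_def single_add algebra_simps)

lemma val_scalar [simp]: "val (group_ring_scalar G c) = c"
  by (rule val_eqI) simp

lemma val_one [simp]: "val \<one>\<^bsub>R\<^esub> = 1"
  using val_scalar[of 1] by (simp add: group_ring_scalar_def group_ring_one)

lemma val_eq_0_iff: "a \<in> carrier R \<Longrightarrow> val a = 0 \<longleftrightarrow> a \<in> M"
  using diff_val_in_M[of a] val_eqI[of a 0] by auto

lemma val_mult:
  assumes a: "a \<in> carrier R" and b: "b \<in> carrier R"
  shows "val (a \<otimes>\<^bsub>R\<^esub> b) = val a * val b"
proof (rule val_eqI)
  let ?s = "group_ring_scalar G"
  have "a \<otimes>\<^bsub>R\<^esub> b - ?s (val a * val b) =
      a \<otimes>\<^bsub>R\<^esub> (b - ?s (val b)) + gscale (val b) (a - ?s (val a))"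
    using group_ring_mult_add_right[of G a "b - ?s (val b)" "?s (val b)"] a
    by (simp add: group_ring.m_comm[of a "?s _"] scalar_mult gvec.scale_right_diff_distrib)
       (simp add: group_ring_scalar_def gscale_single mult.commute)
  also have "\<dots> \<in> M"
    using assms by (intro M_add M_mult M_gscale diff_val_in_M)
  finally show "a \<otimes>\<^bsub>R\<^esub> b - ?s (val a * val b) \<in> M" .
qed

lemma val_sum:
  "(\<And>i. i \<in> I \<Longrightarrow> f i \<in> carrier R) \<Longrightarrow> val (sum f I) = (\<Sum>i\<in>I. val (f i))"
proof (induction I rule: infinite_finite_induct)
  case (insert i I)
  then show ?case by (simp add: val_add group_ring_sum_closed)
qed (use val_scalar[of 0] in simp_all)

lemma val_ring_hom: "ring_hom_ring R cring_class_ops val"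
  by (rule ring_hom_ringI2[OF group_ring.ring_axioms cring.axioms(1)[OF cring_class]])
     (auto simp: ring_hom_def cring_class_ops_def val_add val_mult)

text \<open>\<open>quotient_iso\<close> is a choice, so only its specification can be used. The
  isomorphism induced by \<open>val\<close> shows that the specification is satisfiable; each coset
  is the coset of a scalar, where the specification fixes the value.\<close>

lemma quotient_map_eq_val:
  assumes "\<alpha> \<in> carrier R"
  shows "quotient_map G M \<alpha> = val \<alpha>"
proof -
  have coset: "M +>\<^bsub>R\<^esub> a = {m + a |m. m \<in> M}" for a
    unfolding a_r_coset_def' by auto
  have val_coset: "val ` (M +>\<^bsub>R\<^esub> group_ring_scalar G c) = {c}" for c
  proof -
    have "val (m + group_ring_scalar G c) = c" if "m \<in> M" for m
      using that by (intro val_eqI) simp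
    moreover have "M +>\<^bsub>R\<^esub> group_ring_scalar G c = (\<lambda>m. m + group_ring_scalar G c) ` M"
      unfolding coset by (rule Setcompr_eq_image[of "\<lambda>m. m + group_ring_scalar G c" M])
    ultimately show ?thesis using M_zero by (auto simp: image_image intro!: image_eqI[OF _ M_zero])
  qed
  have "a_kernel R cring_class_ops val = M"
    using M_subset val_eq_0_iff unfolding a_kernel_def' cring_class_ops_def by auto
  moreover have "val ` carrier R = carrier cring_class_ops"
    using image_eqI[where f = val, OF val_scalar[symmetric] scalar_closed] by (auto simp: cring_class_ops_def)
  ultimately have "(\<lambda>X. the_elem (val ` X)) \<in> ring_iso (R Quot M) cring_class_ops"
    using ring_hom_ring.FactRing_iso_set[OF val_ring_hom] by simp
  then have "\<exists>\<iota>. \<iota> \<in> ring_iso (R Quot M) cring_class_ops \<and>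
      (\<forall>c. \<iota> (M +>\<^bsub>R\<^esub> group_ring_scalar G c) = c)"
    by (intro exI[of _ "\<lambda>X. the_elem (val ` X)"]) (simp add: val_coset)
  then have iso: "quotient_iso G M (M +>\<^bsub>R\<^esub> group_ring_scalar G c) = c" for c
    unfolding quotient_iso_def by (rule someI2_ex) simp
  have "M +>\<^bsub>R\<^esub> \<alpha> = M +>\<^bsub>R\<^esub> group_ring_scalar G (val \<alpha>)"
    unfolding coset
  proof safe
    let ?d = "\<alpha> - group_ring_scalar G (val \<alpha>)"
    fix m assume m: "m \<in> M"
    show "\<exists>m'. m + \<alpha> = m' + group_ring_scalar G (val \<alpha>) \<and> m' \<in> M"
      using m M_add[OF m diff_val_in_M[OF assms]] by (intro exI[of _ "m + ?d"]) simp
    show "\<exists>m'. m + group_ring_scalar G (val \<alpha>) = m' + \<alpha> \<and> m' \<in> M"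
      using m M_diff[OF m diff_val_in_M[OF assms]] by (intro exI[of _ "m - ?d"]) simp
  qed
  with iso assms show ?thesis by (simp add: quotient_map_def)
qed

end

section \<open>The Pompeiu property and ideals\<close>

context group_algebra
begin

lemma char_elem_closed: "K \<subseteq> carrier G \<Longrightarrow> char_elem K \<in> carrier R"
  unfolding char_elem_def by (intro group_ring_sum_closed) auto

lemma single_mult_char_elem:
  "Poly_Mapping.single g 1 \<otimes>\<^bsub>R\<^esub> char_elem K = (\<Sum>k\<in>K. Poly_Mapping.single (g \<otimes> k) 1)"
  using sum_comp_morphism[where h = "(\<otimes>\<^bsub>R\<^esub>) (Poly_Mapping.single g 1)"
      and g = "\<lambda>k. Poly_Mapping.single k 1" and A = K]
  by (simp add: char_elem_def group_ring_mult_add_right group_ring_mult_single o_def)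

lemma sum_l_coset:
  assumes "g \<in> carrier G" "K \<subseteq> carrier G"
  shows "(\<Sum>x\<in>g <# K. f x) = (\<Sum>k\<in>K. f (g \<otimes> k))"
proof -
  have "g <# K = (\<lambda>k. g \<otimes> k) ` K" by (auto simp: l_coset_def)
  moreover have "inj_on (\<lambda>k. g \<otimes> k) K" using assms inj_on_cmult inj_on_subset by blast
  ultimately show ?thesis by (simp add: sum.reindex)
qed

text \<open>The linear extension of \<open>f\<close> to \<complex>G: the sum of \<open>f\<close>
  over a translate gK is its value at the product of g and the characteristic element of K.\<close>

definition pairing :: "('a \<Rightarrow> complex) \<Rightarrow> ('a \<Rightarrow>\<^sub>0 complex) \<Rightarrow> complex" where
  "pairing f a = (\<Sum>x\<in>Poly_Mapping.keys a. Poly_Mapping.lookup a x * f x)"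

lemma pairing_single [simp]: "pairing f (Poly_Mapping.single x c) = c * f x"
  by (simp add: pairing_def)

lemma pairing_zero [simp]: "pairing f 0 = 0"
  by (simp add: pairing_def)

lemma pairing_add: "pairing f (a + b) = pairing f a + pairing f b"
  unfolding pairing_def
  by (rule setsum_keys_plus_distrib[where f = "\<lambda>x c. c * f x"]) (simp_all add: distrib_right)

lemma pairing_sum: "pairing f (sum a I) = (\<Sum>i\<in>I. pairing f (a i))"
  by (induction I rule: infinite_finite_induct) (simp_all add: pairing_add)

lemma pairing_gscale: "pairing f (gscale c a) = c * pairing f a"
  by (cases "c = 0") (auto simp: pairing_def in_keys_iff sum_distrib_left mult.assoc intro!: sum.cong)

text \<open>Quantifying over all translates, rather than testing \<open>a\<close> alone, is what
  makes this set an ideal.\<close>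

definition annihilator :: "('a \<Rightarrow> complex) \<Rightarrow> ('a \<Rightarrow>\<^sub>0 complex) set" where
  "annihilator f =
     {a \<in> carrier R. \<forall>g\<in>carrier G. pairing f (Poly_Mapping.single g 1 \<otimes>\<^bsub>R\<^esub> a) = 0}"

text \<open>By additivity \<open>x\<close> may be a multiple of a single group element
  \<open>h\<close>; translating the product by \<open>g\<close> then amounts to translating
  \<open>a\<close> by \<open>g \<otimes> h\<close>, up to a scalar.\<close>

lemma annihilator_mult:
  assumes x: "x \<in> carrier R" and a: "a \<in> annihilator f"
  shows "x \<otimes>\<^bsub>R\<^esub> a \<in> annihilator f"
proof -
  have ac: "a \<in> carrier R" using a by (simp add: annihilator_def)
  have "pairing f (Poly_Mapping.single g 1 \<otimes>\<^bsub>R\<^esub> (x \<otimes>\<^bsub>R\<^esub> a)) = 0" if g: "g \<in> carrier G" for g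
    using x
  proof (induction x rule: group_ring_induct)
    case (single h c)
    have "Poly_Mapping.single g 1 \<otimes>\<^bsub>R\<^esub> (Poly_Mapping.single h c \<otimes>\<^bsub>R\<^esub> a) =
        Poly_Mapping.single (g \<otimes> h) c \<otimes>\<^bsub>R\<^esub> a"
      using g single ac by (simp flip: group_ring.m_assoc add: group_ring_mult_single)
    also have "Poly_Mapping.single (g \<otimes> h) c =
        group_ring_scalar G c \<otimes>\<^bsub>R\<^esub> Poly_Mapping.single (g \<otimes> h) 1"
      using g single by (simp add: group_ring_scalar_def group_ring_mult_single)
    also have "\<dots> \<otimes>\<^bsub>R\<^esub> a = gscale c (Poly_Mapping.single (g \<otimes> h) 1 \<otimes>\<^bsub>R\<^esub> a)"
      using g single ac
      by (subst group_ring.m_assoc) (auto simp: scalar_mult group_ring_mult_closed)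
    finally show ?case
      using a g single by (simp add: pairing_gscale annihilator_def)
  qed (simp_all add: group_ring_mult_add_left group_ring_mult_add_right pairing_add)
  then show ?thesis using x ac by (simp add: annihilator_def)
qed

lemma annihilator_ideal: "ideal (annihilator f) R"
proof (rule idealI)
  show "subgroup (annihilator f) (add_monoid R)"
  proof (rule group_ring.add.subgroupI)
    show "annihilator f \<noteq> {}"
      by (auto simp: annihilator_def group_ring_carrier intro!: exI[of _ 0])
    show "\<ominus>\<^bsub>R\<^esub> a \<in> annihilator f" if a: "a \<in> annihilator f" for a
      using annihilator_mult[of "\<ominus>\<^bsub>R\<^esub> \<one>\<^bsub>R\<^esub>" a f] a
      by (simp add: annihilator_def group_ring.l_minus del: group_ring_a_inv)
  qed (auto simp: annihilator_def group_ring_mult_add_right pairing_add group_ring_add_closed)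
  show "a \<otimes>\<^bsub>R\<^esub> x \<in> annihilator f" if "a \<in> annihilator f" "x \<in> carrier R" for a x
    using annihilator_mult[OF that(2,1)] that by (simp add: group_ring.m_comm annihilator_def)
qed (rule group_ring.ring_axioms annihilator_mult; assumption)+

lemma pompeiu_iff_no_maximalideal:
  assumes rank: "torsion_free_rank G <o |UNIV :: real set|"
    and \<K>: "\<And>K. K \<in> \<K> \<Longrightarrow> K \<subseteq> carrier G"
  shows "pompeiu_property G \<K> \<longleftrightarrow> (\<nexists>M. maximalideal M R \<and> char_elem ` \<K> \<subseteq> M)"
proof
  assume P: "pompeiu_property G \<K>"
  show "\<nexists>M. maximalideal M R \<and> char_elem ` \<K> \<subseteq> M"
  proof safe
    fix M assume M: "maximalideal M R" "char_elem ` \<K> \<subseteq> M"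
    interpret small_rank_maximal_ideal G M
      using M(1) rank group_algebra_axioms
      by (intro small_rank_maximal_ideal.intro maximal_group_algebra.intro
          maximal_group_algebra_axioms.intro small_rank_maximal_ideal_axioms.intro)
    \<comment> \<open>The residue map restricted to \<open>G\<close> is multiplicative, so its sum
      over gK is its value at g times the value of the characteristic element, which is 0. At the
      identity it is 1.\<close>
    let ?f = "\<lambda>x. val (Poly_Mapping.single x 1)"
    have "(\<Sum>x\<in>g <# K. ?f x) = 0" if K: "K \<in> \<K>" and g: "g \<in> carrier G" for K g
    proof -
      have "(\<Sum>x\<in>g <# K. ?f x) = (\<Sum>k\<in>K. ?f (g \<otimes> k))"
        using sum_l_coset[OF g \<K>[OF K]] .
      also have "\<dots> = val (Poly_Mapping.single g 1 \<otimes>\<^bsub>R\<^esub> char_elem K)"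
        unfolding single_mult_char_elem using g \<K>[OF K] by (intro val_sum[symmetric]) auto
      also have "\<dots> = 0"
        using M(2) K g M_subset by (subst val_mult) (auto simp: val_eq_0_iff)
      finally show ?thesis .
    qed
    with P have "?f \<one> = 0" unfolding pompeiu_property_def by blast
    then show False using val_one by (simp add: group_ring_one)
  qed
next
  assume none: "\<nexists>M. maximalideal M R \<and> char_elem ` \<K> \<subseteq> M"
  show "pompeiu_property G \<K>"
    unfolding pompeiu_property_def
  proof (intro allI impI ballI)
    fix f :: "'a \<Rightarrow> complex" and y
    assume f: "\<forall>K\<in>\<K>. \<forall>g\<in>carrier G. (\<Sum>x\<in>g <# K. f x) = 0" and y: "y \<in> carrier G"
    have "char_elem K \<in> annihilator f" if "K \<in> \<K>" for K
      using f that \<K>[OF that]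
      by (simp add: annihilator_def char_elem_closed single_mult_char_elem pairing_sum sum_l_coset[of _ K f, symmetric])
    \<comment> \<open>Otherwise Krull's theorem would provide a maximal ideal above the annihilator,
      containing all characteristic elements.\<close>
    then have "\<one>\<^bsub>R\<^esub> \<in> annihilator f"
      using group_ring.ex_maximalideal_superset[OF annihilator_ideal, of f] none by (metis image_subset_iff subsetD)
    with y show "f y = 0"
      by (auto simp: annihilator_def group_ring_one group_ring_mult_single)
  qed
qed

end

theorem theorem3p1:
  fixes G :: "('a, 'b) monoid_scheme" and \<K> :: "'a set set"
  assumes "comm_group G"
    and "torsion_free_rank G <o |UNIV :: real set|"
    and "finite \<K>"
    and "\<forall>K\<in>\<K>. finite K \<and> K \<subseteq> carrier G"
  shows "pompeiu_property G \<K> \<longleftrightarrow>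
           quotient_maps G \<inter> (\<Inter>K\<in>\<K>. zero_set G (char_elem K)) = {}"
proof -
  interpret group_algebra G
    using assms(1) by (simp add: group_algebra_def)
  have zero: "quotient_map G M (char_elem K) = 0 \<longleftrightarrow> char_elem K \<in> M"
    if "maximalideal M R" "K \<in> \<K>" for M K
  proof -
    interpret small_rank_maximal_ideal G M
      using that(1) assms(2) group_algebra_axioms
      by (intro small_rank_maximal_ideal.intro maximal_group_algebra.intro
          maximal_group_algebra_axioms.intro small_rank_maximal_ideal_axioms.intro)
    show ?thesis
      using assms(4) that(2) by (simp add: quotient_map_eq_val val_eq_0_iff char_elem_closed)
  qed
  \<comment> \<open>The zero sets may present the common map through different maximal ideals, but
    vanishing depends only on the map, so one \<open>M\<close> serves all \<open>K\<close>.
    Membership in \<open>quotient_maps G\<close> supplies this \<open>M\<close> even for empty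
    \<open>\<K>\<close>.\<close>
  have "quotient_maps G \<inter> (\<Inter>K\<in>\<K>. zero_set G (char_elem K)) \<noteq> {} \<longleftrightarrow>
      (\<exists>M. maximalideal M R \<and> (\<forall>K\<in>\<K>. quotient_map G M (char_elem K) = 0))"
    unfolding quotient_maps_def zero_set_def by (fastforce simp: Bex_def)
  also have "\<dots> \<longleftrightarrow> (\<exists>M. maximalideal M R \<and> char_elem ` \<K> \<subseteq> M)"
    using zero by blast
  finally show ?thesis
    using pompeiu_iff_no_maximalideal[OF assms(2), of \<K>] assms(4) by blast
qed

end
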